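(* Let $A$ be an algebra with a chosen element $\ast\in A$. A non-empty subset $I\subseteq A$ is $\ast$-normal if and only if it is both $\ast$-inductive and $\ast$-deductive.
   Context: Algebras are sets with finitary basic operations (of any signature, possibly with constants). A semicongruence on $A$ is a reflexive binary relation on $A$ which is a subalgebra of $A\times A$. For $I\subseteq A$, let $R_I$ be the least semicongruence on $A$ containing $I\times\{\ast\}$. Put $$\mathcal I_\ast(I)=\{x\in A\mid x\,R_I\,y\text{ for some }y\in I\},\qquad \mathcal D_\ast(I)=\{x\in A\mid y\,R_I\,x\text{ for some }y\in I\}.$$ The set $I$ is $\ast$-inductive if $\mathcal I_\ast(I)\subseteq I$, and $\ast$-deductive if $\mathcal D_\ast(I)\subseteq I$. A subset is $\ast$-normal if it is the congruence class of $\ast$ for some congruence on $A$. *)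

theory Defs
  imports Main
begin

text \<open>The operation symbols form a set rather than a whole type, so that the empty signature
  is covered. The interpretation only matters on argument lists over the universe whose
  length is the arity of the symbol; constants are symbols of arity 0.\<close>

record ('f, 'a) alg =
  universe :: "'a set"
  symbols :: "'f set"
  arity :: "'f \<Rightarrow> nat"
  interp :: "'f \<Rightarrow> 'a list \<Rightarrow> 'a"

definition closed_under_operations :: "('f, 'a) alg \<Rightarrow> 'a set \<Rightarrow> bool" where
  "closed_under_operations \<A> S \<longleftrightarrow>
    (\<forall>f\<in>symbols \<A>. \<forall>xs. length xs = arity \<A> f \<longrightarrow> set xs \<subseteq> S \<longrightarrow> interp \<A> f xs \<in> S)"

definition is_algebra :: "('f, 'a) alg \<Rightarrow> bool" where
  "is_algebra \<A> \<longleftrightarrow> closed_under_operations \<A> (universe \<A>)"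

definition subalgebra :: "'a set \<Rightarrow> ('f, 'a) alg \<Rightarrow> bool" where
  "subalgebra S \<A> \<longleftrightarrow> S \<subseteq> universe \<A> \<and> closed_under_operations \<A> S"

definition square :: "('f, 'a) alg \<Rightarrow> ('f, 'a \<times> 'a) alg" where
  "square \<A> =
    \<lparr> universe = universe \<A> \<times> universe \<A>,
      symbols = symbols \<A>,
      arity = arity \<A>,
      interp = (\<lambda>f ps. (interp \<A> f (map fst ps), interp \<A> f (map snd ps))) \<rparr>"

definition semicongruence :: "('f, 'a) alg \<Rightarrow> 'a rel \<Rightarrow> bool" where
  "semicongruence \<A> R \<longleftrightarrow> refl_on (universe \<A>) R \<and> subalgebra R (square \<A>)"

definition congruence :: "('f, 'a) alg \<Rightarrow> 'a rel \<Rightarrow> bool" where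
  "congruence \<A> E \<longleftrightarrow> equiv (universe \<A>) E \<and> subalgebra E (square \<A>)"

definition least_semicongruence :: "('f, 'a) alg \<Rightarrow> 'a \<Rightarrow> 'a set \<Rightarrow> 'a rel" where
  "least_semicongruence \<A> pt I = \<Inter> {R. semicongruence \<A> R \<and> I \<times> {pt} \<subseteq> R}"

text \<open>The intersection is taken over a non-empty family when the data lie in the algebra,
  and it is then indeed the least semicongruence in question. Here pt is the element written as an
  asterisk in the mathematics.\<close>

lemma least_semicongruence_is_least:
  assumes "is_algebra \<A>" and "pt \<in> universe \<A>" and "I \<subseteq> universe \<A>"
  shows "semicongruence \<A> (least_semicongruence \<A> pt I)"
    and "I \<times> {pt} \<subseteq> least_semicongruence \<A> pt I"
    and "\<And>R. semicongruence \<A> R \<Longrightarrow> I \<times> {pt} \<subseteq> R \<Longrightarrow> least_semicongruence \<A> pt I \<subseteq> R"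
proof -
  let ?L = "least_semicongruence \<A> pt I"
  have full_closed: "closed_under_operations (square \<A>) (universe \<A> \<times> universe \<A>)"
    unfolding closed_under_operations_def
  proof (intro ballI allI impI)
    fix f ps
    assume f: "f \<in> symbols (square \<A>)" and len: "length ps = arity (square \<A>) f"
      and ps: "set ps \<subseteq> universe \<A> \<times> universe \<A>"
    have "set (map fst ps) \<subseteq> universe \<A>" "set (map snd ps) \<subseteq> universe \<A>"
      using ps by auto
    moreover have "length (map fst ps) = arity \<A> f" "length (map snd ps) = arity \<A> f"
      using len by (simp_all add: square_def)
    moreover have "f \<in> symbols \<A>"
      using f by (simp add: square_def)
    ultimately have "interp \<A> f (map fst ps) \<in> universe \<A>" "interp \<A> f (map snd ps) \<in> universe \<A>"
      using assms(1) unfolding is_algebra_def closed_under_operations_def by blast+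
    then show "interp (square \<A>) f ps \<in> universe \<A> \<times> universe \<A>"
      by (simp add: square_def)
  qed
  then have full: "semicongruence \<A> (universe \<A> \<times> universe \<A>)"
    by (simp add: semicongruence_def subalgebra_def refl_on_def) (simp add: square_def)
  have full_contains: "I \<times> {pt} \<subseteq> universe \<A> \<times> universe \<A>"
    using assms by auto
  have "?L \<subseteq> universe (square \<A>)"
    using full full_contains unfolding least_semicongruence_def
    by (auto simp: square_def)
  moreover have "closed_under_operations (square \<A>) ?L"
    unfolding closed_under_operations_def
  proof (intro ballI allI impI)
    fix f ps
    assume f: "f \<in> symbols (square \<A>)" and len: "length ps = arity (square \<A>) f"
      and ps: "set ps \<subseteq> ?L"
    show "interp (square \<A>) f ps \<in> ?L"
      unfolding least_semicongruence_def
    proof (rule InterI)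
      fix R
      assume R: "R \<in> {R. semicongruence \<A> R \<and> I \<times> {pt} \<subseteq> R}"
      then have "set ps \<subseteq> R"
        using ps unfolding least_semicongruence_def by blast
      then show "interp (square \<A>) f ps \<in> R"
        using R f len
        unfolding semicongruence_def subalgebra_def closed_under_operations_def by blast
    qed
  qed
  moreover have "refl_on (universe \<A>) ?L"
    by (auto simp: least_semicongruence_def semicongruence_def refl_on_def)
  ultimately show "semicongruence \<A> ?L"
    by (simp add: semicongruence_def subalgebra_def)
  show "I \<times> {pt} \<subseteq> ?L"
    by (auto simp: least_semicongruence_def)
  show "\<And>R. semicongruence \<A> R \<Longrightarrow> I \<times> {pt} \<subseteq> R \<Longrightarrow> ?L \<subseteq> R"
    by (auto simp: least_semicongruence_def)
qed

definition inductive_image :: "('f, 'a) alg \<Rightarrow> 'a \<Rightarrow> 'a set \<Rightarrow> 'a set" where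
  "inductive_image \<A> pt I =
    {x \<in> universe \<A>. \<exists>y\<in>I. (x, y) \<in> least_semicongruence \<A> pt I}"

definition deductive_image :: "('f, 'a) alg \<Rightarrow> 'a \<Rightarrow> 'a set \<Rightarrow> 'a set" where
  "deductive_image \<A> pt I =
    {x \<in> universe \<A>. \<exists>y\<in>I. (y, x) \<in> least_semicongruence \<A> pt I}"

definition pt_inductive :: "('f, 'a) alg \<Rightarrow> 'a \<Rightarrow> 'a set \<Rightarrow> bool" where
  "pt_inductive \<A> pt I \<longleftrightarrow> inductive_image \<A> pt I \<subseteq> I"

definition pt_deductive :: "('f, 'a) alg \<Rightarrow> 'a \<Rightarrow> 'a set \<Rightarrow> bool" where
  "pt_deductive \<A> pt I \<longleftrightarrow> deductive_image \<A> pt I \<subseteq> I"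

definition pt_normal :: "('f, 'a) alg \<Rightarrow> 'a \<Rightarrow> 'a set \<Rightarrow> bool" where
  "pt_normal \<A> pt I \<longleftrightarrow> (\<exists>E. congruence \<A> E \<and> I = E `` {pt})"

end

theory Submission
  imports Defs
begin

text \<open>Write \<open>R\<close> for the least semicongruence containing \<open>I \<times> {pt}\<close>.

  A congruence with \<open>I\<close> as the class of \<open>pt\<close> is a semicongruence that contains
  \<open>I \<times> {pt}\<close>, so it contains \<open>R\<close>; a class is closed under passing along its own
  equivalence relation in either direction, hence also along \<open>R\<close>.

  Conversely, the symmetric transitive closure of any semicongruence is a congruence
  (\<open>congruence_symmetric_trancl\<close>): operations are finitary, so the arguments of an
  operation can be changed one at a time, and reflexivity lets the other arguments rest
  meanwhile. Apply this to \<open>R\<close>. Everything in \<open>I\<close> lies in the class of \<open>pt\<close> because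
  \<open>I \<times> {pt} \<subseteq> R\<close>. In the other direction, a zigzag of \<open>R\<close>-steps starting at \<open>pt\<close> never
  leaves \<open>I\<close>: a forward step stays in \<open>I\<close> by deductivity and a backward step by
  inductivity. The zigzag does start in \<open>I\<close>, since \<open>I\<close> has some element \<open>y\<close>, for which
  \<open>(y, pt) \<in> R\<close>, and deductivity applies.\<close>

lemma congruence_imp_semicongruence: "congruence \<A> E \<Longrightarrow> semicongruence \<A> E"
  by (simp add: congruence_def semicongruence_def equiv_def)

lemma semicongruence_subset:
  "semicongruence \<A> R \<Longrightarrow> R \<subseteq> universe \<A> \<times> universe \<A>"
  by (simp add: semicongruence_def subalgebra_def square_def)

lemma semicongruence_change_argument:
  assumes R: "semicongruence \<A> R" and f: "f \<in> symbols \<A>" and ab: "(a, b) \<in> R"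
    and len: "length (xs @ a # ys) = arity \<A> f"
    and xs: "set xs \<subseteq> universe \<A>" and ys: "set ys \<subseteq> universe \<A>"
  shows "(interp \<A> f (xs @ a # ys), interp \<A> f (xs @ b # ys)) \<in> R"
proof -
  let ?diag = "map (\<lambda>x. (x, x))"
  let ?ps = "?diag xs @ (a, b) # ?diag ys"
  have "set ?ps \<subseteq> R"
    using R ab xs ys by (auto simp: semicongruence_def refl_on_def)
  moreover have "f \<in> symbols (square \<A>)" "length ?ps = arity (square \<A>) f"
    using f len by (simp_all add: square_def)
  ultimately have "interp (square \<A>) f ?ps \<in> R"
    using R unfolding semicongruence_def subalgebra_def closed_under_operations_def by blast
  then show ?thesis
    by (simp add: square_def comp_def)
qed

text \<open>A transitive relation that respects changes of a single argument respects changes of all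
  arguments: walk through the argument list from left to right. The prefix \<open>xs\<close> collects the
  arguments that have already been changed.\<close>

lemma argumentwise_imp_compatible:
  assumes E: "refl_on (universe \<A>) E" "trans E" "E \<subseteq> universe \<A> \<times> universe \<A>"
    and \<A>: "is_algebra \<A>" and f: "f \<in> symbols \<A>"
    and step: "\<And>xs a b ys. (a, b) \<in> E \<Longrightarrow> length (xs @ a # ys) = arity \<A> f \<Longrightarrow>
      set xs \<subseteq> universe \<A> \<Longrightarrow> set ys \<subseteq> universe \<A> \<Longrightarrow>
      (interp \<A> f (xs @ a # ys), interp \<A> f (xs @ b # ys)) \<in> E"
  shows "set ps \<subseteq> E \<Longrightarrow> set xs \<subseteq> universe \<A> \<Longrightarrow> length xs + length ps = arity \<A> f \<Longrightarrow>
    (interp \<A> f (xs @ map fst ps), interp \<A> f (xs @ map snd ps)) \<in> E"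
proof (induction ps arbitrary: xs)
  case Nil
  then show ?case
    using E(1) \<A> f by (auto simp: refl_on_def is_algebra_def closed_under_operations_def)
next
  case (Cons p ps)
  obtain a b where p: "p = (a, b)" by (cases p)
  have ab: "(a, b) \<in> E" and b: "b \<in> universe \<A>"
    using Cons.prems(1) E(3) p by auto
  have "set (map fst ps) \<subseteq> universe \<A>"
    using Cons.prems(1) E(3) by auto
  then have "(interp \<A> f (xs @ a # map fst ps), interp \<A> f (xs @ b # map fst ps)) \<in> E"
    using Cons.prems by (intro step ab) simp_all
  moreover have "(interp \<A> f (xs @ b # map fst ps), interp \<A> f (xs @ b # map snd ps)) \<in> E"
    using Cons.IH[of "xs @ [b]"] Cons.prems b by simp
  ultimately show ?case
    using E(2) p by (auto dest: transD)
qed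

text \<open>The converse of a semicongruence respects the operations as well, so each step of a zigzag
  may be carried through one argument place of an operation. The transitive closure without its
  reflexive part is used because it stays inside the universe.\<close>

lemma congruence_symmetric_trancl:
  assumes \<A>: "is_algebra \<A>" and R: "semicongruence \<A> R"
  shows "congruence \<A> ((R \<union> R\<inverse>)\<^sup>+)"
proof -
  let ?E = "(R \<union> R\<inverse>)\<^sup>+"
  have sub: "?E \<subseteq> universe \<A> \<times> universe \<A>"
    using semicongruence_subset[OF R] by (intro trancl_subset_Sigma) auto
  have refl: "refl_on (universe \<A>) ?E"
    using R by (auto simp: semicongruence_def refl_on_def)
  have sym: "sym ?E"
    by (intro sym_trancl sym_Un_converse)
  have change: "(interp \<A> f (xs @ a # ys), interp \<A> f (xs @ b # ys)) \<in> ?E"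
    if f: "f \<in> symbols \<A>" and ab: "(a, b) \<in> ?E"
      and len: "length (xs @ a # ys) = arity \<A> f"
      and xs: "set xs \<subseteq> universe \<A>" and ys: "set ys \<subseteq> universe \<A>" for f xs a b ys
  proof -
    have zigzag: "(interp \<A> f (xs @ c # ys), interp \<A> f (xs @ d # ys)) \<in> R \<union> R\<inverse>"
      if "(c, d) \<in> R \<union> R\<inverse>" for c d
      using that len xs ys semicongruence_change_argument[OF R f, of c d xs ys]
        semicongruence_change_argument[OF R f, of d c xs ys] by auto
    show ?thesis
      using ab
    proof (induction rule: trancl_induct)
      case (base c)
      then show ?case
        by (rule r_into_trancl[OF zigzag])
    next
      case (step c d)
      show ?case
        by (rule trancl_into_trancl[OF step.IH zigzag[OF step.hyps(2)]])
    qed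
  qed
  have "closed_under_operations (square \<A>) ?E"
    unfolding closed_under_operations_def
  proof (intro ballI allI impI)
    fix f ps
    assume f: "f \<in> symbols (square \<A>)" and len: "length ps = arity (square \<A>) f"
      and ps: "set ps \<subseteq> ?E"
    have f': "f \<in> symbols \<A>"
      using f by (simp add: square_def)
    show "interp (square \<A>) f ps \<in> ?E"
      using argumentwise_imp_compatible
          [OF refl trans_trancl sub \<A> f' change[OF f'], where ps = ps and xs = "[]"]
        ps len by (simp add: square_def)
  qed
  then show ?thesis
    using refl sym sub by (simp add: congruence_def subalgebra_def square_def equiv_def)
qed

theorem theorem2p5:
  fixes \<A> :: "('f, 'a) alg" and pt :: 'a and I :: "'a set"
  assumes "is_algebra \<A>"
    and "pt \<in> universe \<A>"
    and "I \<subseteq> universe \<A>"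
    and "I \<noteq> {}"
  shows "pt_normal \<A> pt I \<longleftrightarrow> pt_inductive \<A> pt I \<and> pt_deductive \<A> pt I"
proof
  let ?R = "least_semicongruence \<A> pt I"
  note least = least_semicongruence_is_least[OF assms(1-3)]
  {
    assume "pt_normal \<A> pt I"
    then obtain E where E: "congruence \<A> E" and I: "I = E `` {pt}"
      by (auto simp: pt_normal_def)
    have sym: "sym E" and trans: "trans E"
      using E by (simp_all add: congruence_def equiv_def)
    have "I \<times> {pt} \<subseteq> E"
      using I sym by (auto dest: symD)
    then have "?R \<subseteq> E"
      by (intro least(3) congruence_imp_semicongruence E)
    then show "pt_inductive \<A> pt I \<and> pt_deductive \<A> pt I"
      unfolding pt_inductive_def pt_deductive_def inductive_image_def deductive_image_def I
      by (blast dest: symD[OF sym] transD[OF trans])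
  next
    assume "pt_inductive \<A> pt I \<and> pt_deductive \<A> pt I"
    then have backward: "\<And>x y. (x, y) \<in> ?R \<Longrightarrow> y \<in> I \<Longrightarrow> x \<in> I"
      and forward: "\<And>x y. (x, y) \<in> ?R \<Longrightarrow> x \<in> I \<Longrightarrow> y \<in> I"
      using semicongruence_subset[OF least(1)]
      unfolding pt_inductive_def pt_deductive_def inductive_image_def deductive_image_def
      by blast+
    let ?E = "(?R \<union> ?R\<inverse>)\<^sup>+"
    have "pt \<in> I"
      using assms(4) least(2) forward by blast
    have "x \<in> I" if "(pt, x) \<in> ?E" for x
      using that \<open>pt \<in> I\<close>
      by (induction rule: trancl_induct) (blast dest: forward backward)+
    moreover have "(pt, x) \<in> ?E" if "x \<in> I" for x
      using that least(2) by blast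
    ultimately have "I = ?E `` {pt}"
      by blast
    then show "pt_normal \<A> pt I"
      using congruence_symmetric_trancl[OF assms(1) least(1)]
      unfolding pt_normal_def by blast
  }
qed

end
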